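(* Consider a convex optimization problem whose objective function $f_0$ is differentiable, and let $D \subseteq \mathbb{R}^n$ denote its feasible set. Then a point $x$ is optimal if and only if $x \in D$ and $$\nabla f_0(x)^T (y - x) \geq 0 \quad \text{for all } y \in D.$$
   Context: A convex optimization problem has the form: minimize $f_0(x)$ subject to $f_i(x) \leq 0$ for $i = 1, \dots, m$ and $h_i(x) = 0$ for $i = 1, \dots, p$, where $f_0, \dots, f_m$ are convex functions (real-valued with convex domains in $\mathbb{R}^n$) and each $h_i(x) = a_i^T x - b_i$ is affine. The feasible set $D$ is the set of points in the domains of all of $f_0,\dots,f_m$ that satisfy all the constraints. A point $x$ is optimal if $x \in D$ and $f_0(x) = \inf\{f_0(z) : z \in D\}$. Convention: $f_0$ differentiable means that its domain is open and $f_0$ is differentiable at every point of its domain. *)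

theory Defs
  imports "HOL-Analysis.Analysis"
begin

text \<open>
  A convex problem over \<open>real ^ 'n\<close> is given by the numbers \<open>m\<close> and \<open>p\<close> of inequality and
  equality constraints, functions \<open>f i\<close> with domains \<open>S i\<close> for \<open>i \<le> m\<close> (where \<open>f 0\<close> is the
  objective), and vectors \<open>a j\<close> and scalars \<open>b j\<close> for \<open>1 \<le> j \<le> p\<close>, the \<open>j\<close>-th equality
  constraint being \<open>a j \<bullet> x - b j = 0\<close>. The values of \<open>f i\<close> outside \<open>S i\<close>, and all data with
  indices out of range, are irrelevant.
\<close>

text \<open>Convexity of \<open>S i\<close> is part of \<^const>\<open>convex_on\<close>.\<close>

definition convex_problem ::
  "nat \<Rightarrow> (nat \<Rightarrow> (real ^ 'n) set) \<Rightarrow> (nat \<Rightarrow> real ^ 'n \<Rightarrow> real) \<Rightarrow> bool"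
  where "convex_problem m S f \<longleftrightarrow> (\<forall>i\<in>{0..m}. convex_on (S i) (f i))"

definition feasible_set ::
  "nat \<Rightarrow> nat \<Rightarrow> (nat \<Rightarrow> (real ^ 'n) set) \<Rightarrow> (nat \<Rightarrow> real ^ 'n \<Rightarrow> real) \<Rightarrow>
    (nat \<Rightarrow> real ^ 'n) \<Rightarrow> (nat \<Rightarrow> real) \<Rightarrow> (real ^ 'n) set"
  where "feasible_set m p S f a b =
    {x. (\<forall>i\<in>{0..m}. x \<in> S i) \<and> (\<forall>i\<in>{1..m}. f i x \<le> 0) \<and> (\<forall>j\<in>{1..p}. a j \<bullet> x - b j = 0)}"

text \<open>
  The infimum is taken in \<^typ>\<open>ereal\<close>, since \<^const>\<open>Inf\<close> on \<^typ>\<open>real\<close> is unspecified for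
  sets that are not bounded below.
\<close>

definition optimal_point :: "(real ^ 'n \<Rightarrow> real) \<Rightarrow> (real ^ 'n) set \<Rightarrow> real ^ 'n \<Rightarrow> bool"
  where "optimal_point g D x \<longleftrightarrow> x \<in> D \<and> ereal (g x) = (INF z\<in>D. ereal (g z))"

definition differentiable_with_domain :: "(real ^ 'n) set \<Rightarrow> (real ^ 'n \<Rightarrow> real) \<Rightarrow> bool"
  where "differentiable_with_domain U g \<longleftrightarrow> open U \<and> (\<forall>x\<in>U. g differentiable (at x))"

definition gradient :: "(real ^ 'n \<Rightarrow> real) \<Rightarrow> real ^ 'n \<Rightarrow> real ^ 'n"
  where "gradient g x = (THE D. GDERIV g x :> D)"

lemma gradient_eqI:
  assumes "GDERIV g x :> D"
  shows "gradient g x = D"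
  unfolding gradient_def
proof (rule the_equality)
  fix E
  assume "GDERIV g x :> E"
  with assms have "(\<lambda>h. h \<bullet> E) = (\<lambda>h. h \<bullet> D)"
    unfolding gderiv_def by (rule has_derivative_unique[rotated])
  then show "E = D"
    by (simp add: fun_eq_iff vector_eq_ldot)
qed (fact assms)

lemma GDERIV_gradient:
  fixes g :: "real ^ 'n \<Rightarrow> real"
  assumes "g differentiable (at x)"
  shows "GDERIV g x :> gradient g x"
proof -
  obtain L where L: "(g has_derivative L) (at x)"
    using assms by (auto simp: differentiable_def)
  then have "linear L"
    by (rule has_derivative_linear)
  then have "L = (\<lambda>h. h \<bullet> adjoint L 1)"
    using adjoint_works[of L _ 1] by (simp add: fun_eq_iff)
  with L have "GDERIV g x :> adjoint L 1"
    by (simp add: gderiv_def)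
  then show ?thesis
    by (simp add: gradient_eqI)
qed

end

theory Submission
  imports Defs
begin

text \<open>
  Everything is read off the restriction of the objective \<open>g\<close> to the segment from \<open>x\<close> to a feasible
  \<open>y\<close>, through the quotients \<open>(g (x + t (y - x)) - g x) / t\<close> for \<open>0 < t \<le> 1\<close>, which tend to
  \<open>\<nabla>g(x)\<^sup>T(y - x)\<close> as \<open>t\<close> decreases to \<open>0\<close> (\<open>GDERIV_imp_quotient_tendsto\<close>).

  If \<open>x\<close> is optimal, then, the feasible set being convex (\<open>convex_feasible_set\<close>), the segment
  consists of feasible points; so all the quotients are nonnegative, and hence so is their limit.
  Conversely, convexity of \<open>g\<close> bounds every quotient by \<open>g y - g x\<close>, the one at \<open>t = 1\<close>. In the
  limit, \<open>g y \<ge> g x + \<nabla>g(x)\<^sup>T(y - x)\<close> (\<open>convex_on_imp_above_gradient\<close>), so that the variational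
  inequality at \<open>x\<close> forces \<open>g y \<ge> g x\<close>.
\<close>

text \<open>Optimality as a comparison of real values, free of the extended-real infimum.\<close>

lemma optimal_point_iff:
  "optimal_point g D x \<longleftrightarrow> x \<in> D \<and> (\<forall>z\<in>D. g x \<le> g z)"
proof (cases "x \<in> D")
  case True
  then have "(INF z\<in>D. ereal (g z)) \<le> ereal (g x)"
    by (rule INF_lower)
  then have "ereal (g x) = (INF z\<in>D. ereal (g z)) \<longleftrightarrow> ereal (g x) \<le> (INF z\<in>D. ereal (g z))"
    by (auto intro: antisym)
  then show ?thesis
    using True by (simp add: optimal_point_def le_INF_iff)
qed (simp add: optimal_point_def)

lemma convex_feasible_set:
  fixes S :: "nat \<Rightarrow> (real ^ 'n) set"
  assumes "convex_problem m S f"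
  shows "convex (feasible_set m p S f a b)"
  unfolding convex_alt
proof (intro ballI allI impI)
  fix x y :: "real ^ 'n" and t :: real
  assume x: "x \<in> feasible_set m p S f a b" and y: "y \<in> feasible_set m p S f a b"
    and t: "0 \<le> t \<and> t \<le> 1"
  let ?z = "(1 - t) *\<^sub>R x + t *\<^sub>R y"
  have f: "convex_on (S i) (f i)" if "i \<in> {0..m}" for i
    using assms that unfolding convex_problem_def by blast
  have "?z \<in> S i" if "i \<in> {0..m}" for i
    using convexD_alt[OF convex_on_imp_convex[OF f[OF that]]] x y t that
    by (auto simp: feasible_set_def)
  moreover have "f i ?z \<le> 0" if i: "i \<in> {1..m}" for i
  proof -
    have "f i ?z \<le> (1 - t) * f i x + t * f i y"
      using convex_onD[OF f[of i]] x y t i by (auto simp: feasible_set_def)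
    also have "\<dots> \<le> 0"
      using x y t i by (intro add_nonpos_nonpos mult_nonneg_nonpos) (auto simp: feasible_set_def)
    finally show ?thesis .
  qed
  moreover have "a j \<bullet> ?z - b j = 0" if j: "j \<in> {1..p}" for j
  proof -
    have "a j \<bullet> x = b j" "a j \<bullet> y = b j"
      using x y j by (auto simp: feasible_set_def)
    then show ?thesis
      by (simp add: inner_add_right algebra_simps)
  qed
  ultimately show "?z \<in> feasible_set m p S f a b"
    by (simp add: feasible_set_def)
qed

text \<open>
  The chain rule along the ray from \<open>x\<close> in the direction \<open>v\<close>. The limit is one-sided because
  the points at negative times need not be feasible.
\<close>

lemma GDERIV_imp_quotient_tendsto:
  assumes "GDERIV g x :> G"
  shows "((\<lambda>t. (g (x + t *\<^sub>R v) - g x) / t) \<longlongrightarrow> G \<bullet> v) (at_right 0)"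
proof -
  have "(g has_derivative (\<lambda>h. h \<bullet> G)) (at (x + 0 *\<^sub>R v))"
    using assms by (simp add: gderiv_def)
  moreover have "((\<lambda>t::real. x + t *\<^sub>R v) has_derivative (\<lambda>h. h *\<^sub>R v)) (at 0)"
    by (auto intro!: derivative_eq_intros)
  ultimately have "((\<lambda>t. g (x + t *\<^sub>R v)) has_derivative (\<lambda>h. (h *\<^sub>R v) \<bullet> G)) (at 0)"
    by (rule has_derivative_compose[rotated])
  then have "((\<lambda>t. g (x + t *\<^sub>R v)) has_field_derivative G \<bullet> v) (at 0)"
    by (simp add: has_field_derivative_def inner_commute mult.commute[of _ "G \<bullet> v"])
  then have "((\<lambda>t. (g (x + t *\<^sub>R v) - g x) / t) \<longlongrightarrow> G \<bullet> v) (at 0)"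
    by (simp add: DERIV_def)
  then show ?thesis
    by (rule filterlim_at_split[THEN iffD1, THEN conjunct2])
qed

text \<open>The first-order bound: a convex function lies above its tangent hyperplanes.\<close>

lemma convex_on_imp_above_gradient:
  assumes "convex_on U g" "x \<in> U" "y \<in> U" "GDERIV g x :> G"
  shows "g x + G \<bullet> (y - x) \<le> g y"
proof -
  have "(g (x + t *\<^sub>R (y - x)) - g x) / t \<le> g y - g x" if "0 < t" "t < 1" for t
  proof -
    have "g (x + t *\<^sub>R (y - x)) = g ((1 - t) *\<^sub>R x + t *\<^sub>R y)"
      by (simp add: algebra_simps)
    also have "\<dots> \<le> (1 - t) * g x + t * g y"
      using that assms by (intro convex_onD) auto
    finally show ?thesis
      using that by (simp add: divide_simps algebra_simps)
  qed
  then have "\<forall>\<^sub>F t in at_right 0. (g (x + t *\<^sub>R (y - x)) - g x) / t \<le> g y - g x"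
    by (auto simp: eventually_at_right_field intro!: exI[of _ 1])
  then have "G \<bullet> (y - x) \<le> g y - g x"
    using tendsto_upperbound[OF GDERIV_imp_quotient_tendsto[OF assms(4)]] by simp
  then show ?thesis
    by simp
qed

text \<open>
  Convexity of \<open>D\<close> makes \<open>y - x\<close> a direction in which one can move without leaving \<open>D\<close>,
  and along such a direction \<open>g\<close> cannot decrease to first order from its minimum.
\<close>

lemma minimum_on_convex_imp_gradient_nonneg:
  assumes "convex D" "x \<in> D" "y \<in> D" "\<And>z. z \<in> D \<Longrightarrow> g x \<le> g z" "GDERIV g x :> G"
  shows "0 \<le> G \<bullet> (y - x)"
proof -
  have "0 \<le> (g (x + t *\<^sub>R (y - x)) - g x) / t" if "0 < t" "t < 1" for t
  proof -
    have "(1 - t) *\<^sub>R x + t *\<^sub>R y \<in> D"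
      using assms(1-3) that by (intro convexD_alt) auto
    then have "x + t *\<^sub>R (y - x) \<in> D"
      by (simp add: algebra_simps)
    then show ?thesis
      using assms(4) that by simp
  qed
  then have "\<forall>\<^sub>F t in at_right 0. 0 \<le> (g (x + t *\<^sub>R (y - x)) - g x) / t"
    by (auto simp: eventually_at_right_field intro!: exI[of _ 1])
  then show ?thesis
    using tendsto_lowerbound[OF GDERIV_imp_quotient_tendsto[OF assms(5)]] by simp
qed

theorem theorem10:
  fixes m p :: nat
    and S :: "nat \<Rightarrow> (real ^ 'n) set"
    and f :: "nat \<Rightarrow> real ^ 'n \<Rightarrow> real"
    and a :: "nat \<Rightarrow> real ^ 'n"
    and b :: "nat \<Rightarrow> real"
    and D :: "(real ^ 'n) set"
    and x :: "real ^ 'n"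
  assumes "convex_problem m S f"
    and "differentiable_with_domain (S 0) (f 0)"
    and "D = feasible_set m p S f a b"
  shows "optimal_point (f 0) D x \<longleftrightarrow>
    x \<in> D \<and> (\<forall>y\<in>D. gradient (f 0) x \<bullet> (y - x) \<ge> 0)"
proof (cases "x \<in> D")
  case True
  have D: "D \<subseteq> S 0"
    using assms(3) by (auto simp: feasible_set_def)
  have f0: "convex_on (S 0) (f 0)"
    using assms(1) by (simp add: convex_problem_def)
  have G: "GDERIV (f 0) x :> gradient (f 0) x"
    using assms(2) True D by (intro GDERIV_gradient) (auto simp: differentiable_with_domain_def)
  have "convex D"
    using assms(1,3) by (simp add: convex_feasible_set)
  have "(\<forall>y\<in>D. f 0 x \<le> f 0 y) \<longleftrightarrow> (\<forall>y\<in>D. gradient (f 0) x \<bullet> (y - x) \<ge> 0)"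
  proof (intro iffI ballI)
    fix y
    assume "\<forall>y\<in>D. f 0 x \<le> f 0 y" "y \<in> D"
    then show "gradient (f 0) x \<bullet> (y - x) \<ge> 0"
      using \<open>convex D\<close> True G by (intro minimum_on_convex_imp_gradient_nonneg) auto
  next
    fix y
    assume "\<forall>y\<in>D. gradient (f 0) x \<bullet> (y - x) \<ge> 0" "y \<in> D"
    moreover from this have "f 0 x + gradient (f 0) x \<bullet> (y - x) \<le> f 0 y"
      using True D G by (intro convex_on_imp_above_gradient[OF f0]) auto
    ultimately show "f 0 x \<le> f 0 y"
      by force
  qed
  then show ?thesis
    by (simp add: optimal_point_iff)
qed (simp add: optimal_point_iff)

end
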